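(* For every integer $m\ge 3$ there exists a 3-connected graph $G_m$ having a 2-connected spanning subgraph $H_m$ such that $\gamma_g(G_m)\ge 2m-2$ and $\gamma_g(H_m)=m$.
   Context: Graphs are finite, simple and nonempty. A spanning subgraph of $G$ is a subgraph with the same vertex set as $G$; connectivity is vertex-connectivity. For a vertex $v$, $N[v]$ is its closed neighborhood; a chosen vertex $v$ dominates all vertices of $N[v]$. The domination game on a graph $G$ is played by two players, Dominator and Staller, who alternately choose vertices of $G$; each chosen vertex must dominate at least one vertex that was not dominated by the previously chosen vertices. The game ends when all vertices of $G$ are dominated. Dominator wants the total number of chosen vertices to be as small as possible, Staller wants it to be as large as possible. The game domination number $\gamma_g(G)$ is the total number of vertices chosen (by both players) when Dominator makes the first move and both players play optimally. *)

theory Defs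
  imports "Graph_Theory.Graph_Theory"
begin

text \<open>
  Finite simple graphs are the \<open>pair_graph\<close>s of \<open>Graph_Theory\<close>: finite, loop-free digraphs whose
  arc set is a symmetric relation, each undirected edge being the pair of its two orientations.
\<close>

text \<open>
  The bound on the order is the usual convention under which the complete graph on \<open>n\<close> vertices
  has connectivity \<open>n - 1\<close>; it also makes every \<open>k\<close>-connected graph finite and nonempty.
\<close>

definition k_connected :: "nat \<Rightarrow> ('a, 'b) pre_digraph \<Rightarrow> bool" where
  "k_connected k G \<longleftrightarrow>
     k < card (verts G) \<and>
     (\<forall>S \<subseteq> verts G. card S < k \<longrightarrow> connected (G \<restriction> (verts G - S)))"

definition closed_neighborhood :: "('a, 'b) pre_digraph \<Rightarrow> 'a \<Rightarrow> 'a set" where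
  "closed_neighborhood G v = insert v {u. v \<rightarrow>\<^bsub>G\<^esub> u}"

definition dominated :: "('a, 'b) pre_digraph \<Rightarrow> 'a set \<Rightarrow> 'a set" where
  "dominated G S = (\<Union>v\<in>S. closed_neighborhood G v)"

definition legal_moves :: "('a, 'b) pre_digraph \<Rightarrow> 'a set \<Rightarrow> 'a set" where
  "legal_moves G S = {v \<in> verts G. \<not> closed_neighborhood G v \<subseteq> dominated G S}"

datatype player = Dominator | Staller

text \<open>
  \<open>remaining_moves G p S\<close> is the minimax number of vertices still to be chosen when the vertices
  in \<open>S\<close> have been chosen and \<open>p\<close> is to move. As long as some vertex is undominated, choosing it
  is a legal move, so \<open>Min\<close> and \<open>Max\<close> range over nonempty sets. The finiteness
  guard is only needed for termination; infinite graphs get the junk value 0.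
\<close>

function remaining_moves :: "('a, 'b) pre_digraph \<Rightarrow> player \<Rightarrow> 'a set \<Rightarrow> nat" where
  "remaining_moves G p S =
     (if infinite (verts G) \<or> verts G \<subseteq> dominated G S then 0
      else case p of
        Dominator \<Rightarrow> 1 + Min ((\<lambda>v. remaining_moves G Staller (insert v S)) ` legal_moves G S)
      | Staller \<Rightarrow> 1 + Max ((\<lambda>v. remaining_moves G Dominator (insert v S)) ` legal_moves G S))"
  by pat_completeness auto

lemma legal_moves_decrease:
  assumes "finite (verts G)" "v \<in> legal_moves G S"
  shows "card (verts G - insert v S) < card (verts G - S)"
proof (rule psubset_card_mono)
  have "v \<in> verts G" "v \<notin> S"
    using assms(2) by (auto simp: legal_moves_def dominated_def)
  then show "verts G - insert v S \<subset> verts G - S" by blast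
qed (use assms(1) in simp)

termination remaining_moves
  by (relation "measure (\<lambda>(G, p, S). card (verts G - S))") (auto intro: legal_moves_decrease)

declare remaining_moves.simps [simp del]

definition game_domination_number :: "('a, 'b) pre_digraph \<Rightarrow> nat" (\<open>\<gamma>\<^sub>g\<close>) where
  "\<gamma>\<^sub>g G = remaining_moves G Dominator {}"

lemma legal_moves_nonempty:
  assumes "\<not> verts G \<subseteq> dominated G S"
  shows "legal_moves G S \<noteq> {}"
  using assms by (auto simp: legal_moves_def closed_neighborhood_def)

end

theory Submission
  imports Defs
begin

text \<open>
  The vertices form an array with \<open>m\<close> rows, each of them a clique. Column 0 has no edges between
  rows, so every row must receive a move and every game lasts at least \<open>m\<close> moves. In \<open>H\<close> the only
  edges between rows join columns 1, 2, 3, which form one large clique; this makes \<open>H\<close> 3-connected,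
  and once Dominator has opened in that clique every legal move enters a new row.
  In \<open>G\<close> each of \<open>2 * m\<close> further columns is a clique as well. As long as some row has not been
  entered and fewer than \<open>2 * m\<close> moves have been made, Staller can therefore move in an unused
  column of a row that was entered before, so that only Dominator enters new rows.
\<close>

section \<open>Bounds for the domination game\<close>

lemma finite_legal_moves: "finite (verts G) \<Longrightarrow> finite (legal_moves G S)"
  by (simp add: legal_moves_def)

lemma remaining_moves_Dominator_ge:
  assumes "finite (verts G)" "\<not> verts G \<subseteq> dominated G S"
    and "\<And>v. v \<in> legal_moves G S \<Longrightarrow> k \<le> remaining_moves G Staller (insert v S)"
  shows "Suc k \<le> remaining_moves G Dominator S"
  using assms legal_moves_nonempty[OF assms(2)] finite_legal_moves[OF assms(1), of S]
  by (subst remaining_moves.simps) simp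

lemma remaining_moves_Dominator_le:
  assumes "finite (verts G)" "v \<in> legal_moves G S"
    and "remaining_moves G Staller (insert v S) \<le> k"
  shows "remaining_moves G Dominator S \<le> Suc k"
proof -
  have "Min ((\<lambda>v. remaining_moves G Staller (insert v S)) ` legal_moves G S) \<le> k"
    using assms finite_legal_moves[OF assms(1), of S] by (meson Min_le finite_imageI imageI le_trans)
  then show ?thesis by (subst remaining_moves.simps) simp
qed

lemma remaining_moves_Staller_ge:
  assumes "finite (verts G)" "\<not> verts G \<subseteq> dominated G S" "v \<in> legal_moves G S"
    and "k \<le> remaining_moves G Dominator (insert v S)"
  shows "Suc k \<le> remaining_moves G Staller S"
proof -
  have "k \<le> Max ((\<lambda>v. remaining_moves G Dominator (insert v S)) ` legal_moves G S)"
    using assms finite_legal_moves[OF assms(1), of S] by (meson Max_ge finite_imageI imageI le_trans)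
  then show ?thesis using assms by (subst remaining_moves.simps) simp
qed

lemma remaining_moves_Staller_le:
  assumes "finite (verts G)" "\<not> verts G \<subseteq> dominated G S"
    and "\<And>v. v \<in> legal_moves G S \<Longrightarrow> remaining_moves G Dominator (insert v S) \<le> k"
  shows "remaining_moves G Staller S \<le> Suc k"
  using assms legal_moves_nonempty[OF assms(2)] finite_legal_moves[OF assms(1), of S]
  by (subst remaining_moves.simps) simp

text \<open>Strategies are irrelevant here: if no legal move, by either player, lowers \<Phi> by
  more than one, and \<Phi> vanishes once the game is over, then every way of playing on lasts at
  least \<Phi> \<open>S\<close> moves.\<close>

lemma remaining_moves_ge_potential:
  assumes "finite (verts G)"
    and inv: "\<And>S v. P S \<Longrightarrow> v \<in> legal_moves G S \<Longrightarrow> P (insert v S)"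
    and step: "\<And>S v. P S \<Longrightarrow> v \<in> legal_moves G S \<Longrightarrow> \<Phi> S \<le> Suc (\<Phi> (insert v S))"
    and over: "\<And>S. P S \<Longrightarrow> verts G \<subseteq> dominated G S \<Longrightarrow> \<Phi> S = 0"
    and "P S"
  shows "\<Phi> S \<le> remaining_moves G p S"
  using \<open>P S\<close>
proof (induction "card (verts G - S)" arbitrary: S p rule: less_induct)
  case less
  show ?case
  proof (cases "verts G \<subseteq> dominated G S")
    case True
    then show ?thesis using over less.prems by simp
  next
    case False
    have ge: "\<Phi> S - 1 \<le> remaining_moves G q (insert v S)" if "v \<in> legal_moves G S" for v q
    proof -
      have "\<Phi> (insert v S) \<le> remaining_moves G q (insert v S)"
        by (rule less.hyps[OF legal_moves_decrease[OF assms(1) that] inv[OF less.prems that]])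
      then show ?thesis using step[OF less.prems that] by simp
    qed
    obtain v where v: "v \<in> legal_moves G S" using legal_moves_nonempty[OF False] by blast
    \<comment> \<open>The subtraction is truncated, so the left side is at least \<Phi>
      \<open>S\<close> even when \<Phi> \<open>S\<close> is 0.\<close>
    have "Suc (\<Phi> S - 1) \<le> remaining_moves G p S"
    proof (cases p)
      case Dominator
      then show ?thesis using remaining_moves_Dominator_ge[OF assms(1) False ge] by simp
    next
      case Staller
      then show ?thesis using remaining_moves_Staller_ge[OF assms(1) False v ge[OF v]] by simp
    qed
    then show ?thesis by simp
  qed
qed

text \<open>Dual bound: every legal move, good or bad, costs at least one unit of \<Phi>, and a
  natural number cannot drop below 0.\<close>

lemma remaining_moves_le_potential:
  assumes "finite (verts G)"
    and inv: "\<And>S v. P S \<Longrightarrow> v \<in> legal_moves G S \<Longrightarrow> P (insert v S)"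
    and step: "\<And>S v. P S \<Longrightarrow> v \<in> legal_moves G S \<Longrightarrow> Suc (\<Phi> (insert v S)) \<le> \<Phi> S"
    and "P S"
  shows "remaining_moves G p S \<le> \<Phi> S"
  using \<open>P S\<close>
proof (induction "card (verts G - S)" arbitrary: S p rule: less_induct)
  case less
  show ?case
  proof (cases "verts G \<subseteq> dominated G S")
    case True
    then show ?thesis by (subst remaining_moves.simps) simp
  next
    case False
    have le: "remaining_moves G q (insert v S) \<le> \<Phi> S - 1" if "v \<in> legal_moves G S" for v q
    proof -
      have "remaining_moves G q (insert v S) \<le> \<Phi> (insert v S)"
        by (rule less.hyps[OF legal_moves_decrease[OF assms(1) that] inv[OF less.prems that]])
      then show ?thesis using step[OF less.prems that] by simp
    qed
    obtain v where v: "v \<in> legal_moves G S" using legal_moves_nonempty[OF False] by blast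
    have "remaining_moves G p S \<le> Suc (\<Phi> S - 1)"
    proof (cases p)
      case Dominator
      then show ?thesis using remaining_moves_Dominator_le[OF assms(1) v le[OF v]] by simp
    next
      case Staller
      then show ?thesis using remaining_moves_Staller_le[OF assms(1) False le] by simp
    qed
    \<comment> \<open>The legal move \<open>v\<close> forces \<Phi> \<open>S\<close> to be positive,
      so the truncated subtraction is exact.\<close>
    then show ?thesis using step[OF less.prems v] by simp
  qed
qed

section \<open>Arrays of cliques\<close>

definition cell :: "nat \<Rightarrow> nat \<Rightarrow> nat" where
  "cell i s = prod_encode (i, s)"

definition row :: "nat \<Rightarrow> nat" where
  "row v = fst (prod_decode v)"

definition col :: "nat \<Rightarrow> nat" where
  "col v = snd (prod_decode v)"

lemma row_cell [simp]: "row (cell i s) = i" and col_cell [simp]: "col (cell i s) = s"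
  by (simp_all add: cell_def row_def col_def)

lemma cell_row_col [simp]: "cell (row v) (col v) = v"
  by (simp add: cell_def row_def col_def)

text \<open>Diagonal pairs of \<open>R\<close> matter: \<open>(s, s)\<close> turns column
  \<open>s\<close> into a clique, and a square \<open>A \<times> A\<close> turns the union of the
  columns in \<open>A\<close> into one. A column outside the field of \<open>R\<close> has edges
  only along rows.\<close>

definition clique_array :: "nat \<Rightarrow> nat \<Rightarrow> nat rel \<Rightarrow> nat pair_pre_digraph" where
  "clique_array m n R =
    \<lparr>pverts = {v. row v < m \<and> col v < n},
     parcs = {(u, v). row u < m \<and> col u < n \<and> row v < m \<and> col v < n \<and> u \<noteq> v \<and>
                      (row u = row v \<or> (col u, col v) \<in> R)}\<rparr>"

lemma in_pverts_clique_array [simp]: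
  "v \<in> pverts (clique_array m n R) \<longleftrightarrow> row v < m \<and> col v < n"
  by (simp add: clique_array_def)

lemma in_parcs_clique_array:
  "(u, v) \<in> parcs (clique_array m n R) \<longleftrightarrow>
    u \<in> pverts (clique_array m n R) \<and> v \<in> pverts (clique_array m n R) \<and> u \<noteq> v \<and>
    (row u = row v \<or> (col u, col v) \<in> R)"
  by (auto simp: clique_array_def)

lemma pverts_clique_array: "pverts (clique_array m n R) = case_prod cell ` ({..<m} \<times> {..<n})"
proof -
  have "v \<in> case_prod cell ` ({..<m} \<times> {..<n})" if "row v < m" "col v < n" for v
    using that by (intro image_eqI[of _ _ "(row v, col v)"]) auto
  then show ?thesis by auto
qed

lemma finite_pverts_clique_array [simp]: "finite (pverts (clique_array m n R))"
  by (simp add: pverts_clique_array)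

lemma card_pverts_clique_array: "card (pverts (clique_array m n R)) = m * n"
proof -
  have "inj_on (case_prod cell) ({..<m} \<times> {..<n})" by (auto simp: inj_on_def cell_def)
  then show ?thesis by (simp add: pverts_clique_array card_image)
qed

lemma pair_graph_clique_array:
  assumes "sym R"
  shows "pair_graph (clique_array m n R)"
proof
  let ?G = "clique_array m n R"
  have "parcs ?G \<subseteq> pverts ?G \<times> pverts ?G" by (auto simp: in_parcs_clique_array)
  then show "finite (parcs ?G)" by (rule finite_subset) simp
  show "symmetric (with_proj ?G)"
    using assms by (auto simp: symmetric_def sym_def in_parcs_clique_array)
qed (auto simp: in_parcs_clique_array)

lemma spanning_clique_array:
  assumes "sym Q" "sym R" "Q \<subseteq> R"
  shows "spanning (with_proj (clique_array m n Q)) (with_proj (clique_array m n R))"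
proof -
  interpret Q: pair_graph "clique_array m n Q" by (rule pair_graph_clique_array) fact
  interpret R: pair_graph "clique_array m n R" by (rule pair_graph_clique_array) fact
  show ?thesis
    unfolding spanning_def subgraph_def
    using assms(3) Q.wf_digraph R.wf_digraph by (auto simp: in_parcs_clique_array)
qed

section \<open>Connectivity of clique arrays\<close>

text \<open>Fewer than three deletions leave in each row a vertex of columns 1 to 3. Any two
  survivors are linked by walking inside the first row to such a vertex, crossing to one in the
  second row, and walking inside that row.\<close>

lemma connected_clique_array_delete:
  assumes "m > 0" "n > 3" "{1..3} \<times> {1..3} \<subseteq> R" "finite S" "card S < 3"
  shows "connected (with_proj (clique_array m n R) \<restriction> (pverts (clique_array m n R) - S))"
    (is "connected (with_proj ?G \<restriction> ?W)")
proof -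
  let ?E = "(arcs_ends (with_proj ?G \<restriction> ?W))\<^sup>s"
  have hub: "\<exists>s\<in>{1..3}. cell i s \<notin> S" for i
  proof (rule ccontr)
    assume "\<not> ?thesis"
    then have "cell i ` {1..3} \<subseteq> S" by auto
    moreover have "card (cell i ` {1..3}) = 3"
      by (subst card_image) (auto simp: inj_on_def cell_def)
    ultimately show False using card_mono[OF assms(4), of "cell i ` {1..3}"] assms(5) by simp
  qed
  have step: "(u, v) \<in> rtrancl_on ?W ?E"
    if "u \<in> ?W" "v \<in> ?W" "row u = row v \<or> (col u, col v) \<in> R" for u v
  proof (cases "u = v")
    case True
    then show ?thesis using that by simp
  next
    case False
    with that have "(u, v) \<in> arcs (with_proj ?G \<restriction> ?W)"
      by (simp add: in_parcs_clique_array)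
    then have "(u, v) \<in> ?E"
      by (simp add: arcs_ends_conv symcl_def image_def)
    then show ?thesis
      by (rule rtrancl_on_into_rtrancl_on[OF rtrancl_on_refl[OF that(1)] _ that(2)])
  qed
  have "(u, v) \<in> rtrancl_on ?W ?E" if "u \<in> ?W" "v \<in> ?W" for u v
  proof -
    obtain s t where "s \<in> {1..3}" "cell (row u) s \<notin> S" "t \<in> {1..3}" "cell (row v) t \<notin> S"
      using hub by meson
    moreover from this have "(s, t) \<in> R" using assms(3) by blast
    ultimately have x: "cell (row u) s \<in> ?W" "cell (row v) t \<in> ?W" "(s, t) \<in> R"
      using that assms(2) by simp_all
    have "(u, cell (row u) s) \<in> rtrancl_on ?W ?E" using that x by (intro step) auto
    also have "(cell (row u) s, cell (row v) t) \<in> rtrancl_on ?W ?E" using x by (intro step) auto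
    also (rtrancl_on_trans) have "(cell (row v) t, v) \<in> rtrancl_on ?W ?E" using that x by (intro step) auto
    finally (rtrancl_on_trans) show ?thesis .
  qed
  moreover have "?W \<noteq> {}"
  proof -
    obtain s where "s \<in> {1..3}" "cell 0 s \<notin> S" using hub by blast
    then have "cell 0 s \<in> ?W" using assms(1,2) by simp
    then show ?thesis by force
  qed
  ultimately show ?thesis by (simp add: connected_conv)
qed

lemma k_connected_clique_array:
  assumes "m > 0" "n > 3" "{1..3} \<times> {1..3} \<subseteq> R" "k \<le> 3"
  shows "k_connected k (with_proj (clique_array m n R))"
proof -
  have "1 * n \<le> m * n" using assms by (intro mult_le_mono) auto
  then have "k < m * n" using assms by linarith
  moreover have "connected (with_proj (clique_array m n R) \<restriction> (pverts (clique_array m n R) - S))"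
    if "S \<subseteq> pverts (clique_array m n R)" "card S < k" for S
    using that assms finite_subset[OF that(1)] by (intro connected_clique_array_delete) simp_all
  ultimately show ?thesis by (simp add: k_connected_def card_pverts_clique_array)
qed

section \<open>Domination and open rows in clique arrays\<close>

lemma closed_neighborhood_clique_array:
  assumes "v \<in> pverts (clique_array m n R)"
  shows "closed_neighborhood (with_proj (clique_array m n R)) v =
    {u \<in> pverts (clique_array m n R). row v = row u \<or> (col v, col u) \<in> R}"
  using assms by (auto simp: closed_neighborhood_def in_parcs_clique_array)

lemma in_dominated_clique_array:
  assumes "S \<subseteq> pverts (clique_array m n R)"
  shows "u \<in> dominated (with_proj (clique_array m n R)) S \<longleftrightarrow>
    u \<in> pverts (clique_array m n R) \<and> (\<exists>v\<in>S. row v = row u \<or> (col v, col u) \<in> R)"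
proof -
  let ?G = "clique_array m n R"
  have *: "u \<in> closed_neighborhood (with_proj ?G) v \<longleftrightarrow>
      u \<in> pverts ?G \<and> (row v = row u \<or> (col v, col u) \<in> R)" if "v \<in> S" for v
    unfolding closed_neighborhood_clique_array[OF subsetD[OF assms that]] by (rule mem_Collect_eq)
  show ?thesis
    unfolding dominated_def UN_iff Bex_def using * by metis
qed

lemma in_legal_moves_clique_array:
  assumes "S \<subseteq> pverts (clique_array m n R)"
  shows "v \<in> legal_moves (with_proj (clique_array m n R)) S \<longleftrightarrow>
    v \<in> pverts (clique_array m n R) \<and>
    (\<exists>u\<in>pverts (clique_array m n R). (row v = row u \<or> (col v, col u) \<in> R) \<and>
       (\<forall>w\<in>S. row w \<noteq> row u \<and> (col w, col u) \<notin> R))"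
proof (cases "v \<in> pverts (clique_array m n R)")
  case True
  then show ?thesis
    by (auto simp: legal_moves_def closed_neighborhood_clique_array[OF True]
        in_dominated_clique_array[OF assms] subset_iff Bex_def simp del: in_pverts_clique_array)
qed (auto simp: legal_moves_def)

text \<open>The number of open rows is the potential in the game bounds; a move can close only its
  own row.\<close>

definition open_rows :: "nat \<Rightarrow> nat set \<Rightarrow> nat set" where
  "open_rows m S = {..<m} - row ` S"

lemma finite_open_rows [simp]: "finite (open_rows m S)"
  by (simp add: open_rows_def)

lemma open_rows_insert: "open_rows m (insert v S) = open_rows m S - {row v}"
  by (auto simp: open_rows_def)

lemma card_open_rows_insert: "card (open_rows m S) \<le> Suc (card (open_rows m (insert v S)))"
  unfolding open_rows_insert by (auto simp: card_Diff_singleton_if)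

text \<open>As 0 is not in the range of \<open>R\<close>, the vertex in column 0 of an open row can
  only be dominated from that row.\<close>

lemma not_dominated_if_open_rows:
  assumes "S \<subseteq> pverts (clique_array m n R)" "n > 0" "0 \<notin> Range R" "open_rows m S \<noteq> {}"
  shows "\<not> pverts (clique_array m n R) \<subseteq> dominated (with_proj (clique_array m n R)) S"
proof -
  obtain i where "i < m" "i \<notin> row ` S" using assms(4) by (auto simp: open_rows_def)
  then have "cell i 0 \<in> pverts (clique_array m n R)"
    "cell i 0 \<notin> dominated (with_proj (clique_array m n R)) S"
    using assms(1-3) by (auto simp: in_dominated_clique_array)
  then show ?thesis by (meson subsetD)
qed

lemma game_domination_number_clique_array_ge:
  assumes "n > 0" "0 \<notin> Range R"
  shows "m \<le> \<gamma>\<^sub>g (with_proj (clique_array m n R))"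
proof -
  let ?G = "with_proj (clique_array m n R)"
  have "card (open_rows m {}) \<le> remaining_moves ?G Dominator {}"
  proof (rule remaining_moves_ge_potential[where P = "\<lambda>S. S \<subseteq> verts ?G"])
    show "card (open_rows m S) = 0" if "S \<subseteq> verts ?G" "verts ?G \<subseteq> dominated ?G S" for S
      using not_dominated_if_open_rows[OF _ assms, of S m] that by auto
  qed (auto simp: legal_moves_def card_open_rows_insert)
  then show ?thesis by (simp add: game_domination_number_def open_rows_def)
qed

text \<open>Dominator opens at \<open>cell 0 s\<close>, which dominates all columns in
  \<open>A\<close>. A vertex newly dominated later lies outside these columns, so it is reached
  along its row, and that row was open. Hence each later move closes one of the remaining
  \<open>m - 1\<close> rows.\<close>

lemma game_domination_number_clique_array_le:
  assumes "m > 0" "n > s" and R: "R = A \<times> A" and "s \<in> A"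
  shows "\<gamma>\<^sub>g (with_proj (clique_array m n R)) \<le> m"
proof -
  let ?G = "with_proj (clique_array m n R)" and ?c = "cell 0 s"
  have "remaining_moves ?G Staller {?c} \<le> card (open_rows m {?c})"
  proof (rule remaining_moves_le_potential[where P = "\<lambda>S. S \<subseteq> verts ?G \<and> ?c \<in> S"])
    fix S v assume S: "S \<subseteq> verts ?G \<and> ?c \<in> S" and v: "v \<in> legal_moves ?G S"
    then obtain u where "row v < m" "row v = row u \<or> (col v, col u) \<in> R"
      and u: "\<forall>w\<in>S. row w \<noteq> row u \<and> (col w, col u) \<notin> R"
      using in_legal_moves_clique_array[of S m n R v] by auto
    moreover have "col u \<notin> A" using S u assms by force
    ultimately have "row v = row u" using R by blast
    then have "row v \<in> open_rows m S" using u \<open>row v < m\<close> by (auto simp: open_rows_def)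
    then show "Suc (card (open_rows m (insert v S))) \<le> card (open_rows m S)"
      by (simp add: open_rows_insert card_Suc_Diff1 del: card_Diff_insert)
  qed (use assms in \<open>auto simp: legal_moves_def\<close>)
  moreover have "?c \<in> legal_moves ?G {}"
    using assms by (auto simp: in_legal_moves_clique_array intro!: bexI[of _ ?c])
  moreover have "Suc (card (open_rows m {?c})) = m"
  proof -
    have "open_rows m {?c} = {..<m} - {0}" by (auto simp: open_rows_def)
    then show ?thesis using assms by simp
  qed
  ultimately show ?thesis
    unfolding game_domination_number_def by (metis finite_pverts_clique_array
        remaining_moves_Dominator_le with_proj_simps(1))
qed

section \<open>Staller's strategy\<close>

text \<open>Some column \<open>t\<close> in \<open>C\<close> contains no chosen vertex, because
  there are fewer chosen vertices than columns in \<open>C\<close>. In an open row \<open>j\<close>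
  the vertex \<open>cell j t\<close> is then undominated, and it can be dominated along its column
  from a row that was entered before.\<close>

lemma exists_idle_move:
  assumes S: "S \<subseteq> pverts (clique_array m n R)" "S \<noteq> {}" and "open_rows m S \<noteq> {}"
    and C: "C \<subseteq> {..<n}" "finite C" "card S < card C"
      "\<And>s t. t \<in> C \<Longrightarrow> (s, t) \<in> R \<longleftrightarrow> s = t"
  shows "\<exists>v\<in>legal_moves (with_proj (clique_array m n R)) S. row v \<in> row ` S"
proof -
  have "finite S" using S finite_subset by fastforce
  then have "card (col ` S) < card C" using card_image_le[of S col] C(3) by simp
  then obtain t where t: "t \<in> C" "t \<notin> col ` S"
    using \<open>finite S\<close> by (metis card_mono finite_imageI not_le subsetI)
  obtain w where w: "w \<in> S" using S by blast
  obtain j where j: "j < m" "j \<notin> row ` S" using assms(3) by (auto simp: open_rows_def)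
  have "cell (row w) t \<in> legal_moves (with_proj (clique_array m n R)) S"
    unfolding in_legal_moves_clique_array[OF S(1)]
    using t w j S C by (auto intro!: bexI[of _ "cell j t"])
  then show ?thesis using w by (intro bexI[of _ "cell (row w) t"]) simp_all
qed

text \<open>
  Dominator enters at most one new row per round and Staller none; the bound on \<open>card S\<close> is
  what remains of the supply \<open>C\<close> of columns if at most two of them are used up per round.
\<close>

lemma remaining_moves_clique_array_ge:
  assumes "n > 0" "0 \<notin> Range R"
    and C: "C \<subseteq> {..<n}" "finite C" "\<And>s t. t \<in> C \<Longrightarrow> (s, t) \<in> R \<longleftrightarrow> s = t"
    and "S \<subseteq> pverts (clique_array m n R)" "k \<le> card (open_rows m S)" "card S + 2 * k \<le> card C"
  shows "2 * k - 1 \<le> remaining_moves (with_proj (clique_array m n R)) Dominator S"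
  using assms(6-8)
proof (induction k arbitrary: S)
  case 0
  then show ?case by simp
next
  case (Suc k)
  let ?G = "with_proj (clique_array m n R)"
  have fin: "finite (verts ?G)" by simp
  have "finite S" using Suc.prems(1) finite_subset by fastforce
  have "open_rows m S \<noteq> {}" using Suc.prems by auto
  then have undom: "\<not> verts ?G \<subseteq> dominated ?G S"
    using not_dominated_if_open_rows assms Suc.prems by simp
  have "2 * k \<le> remaining_moves ?G Staller (insert v S)" if v: "v \<in> legal_moves ?G S" for v
  proof (cases "k = 0")
    \<comment> \<open>Dominator's move may have closed the last open row, so no reply by Staller is
      guaranteed; this is why the bound is \<open>2 * k - 1\<close> and not
      \<open>2 * k\<close>.\<close>
    case True
    then show ?thesis by simp
  next
    case False
    let ?T = "insert v S"
    have T: "?T \<subseteq> pverts (clique_array m n R)" using v Suc.prems by (auto simp: legal_moves_def)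
    have k: "k \<le> card (open_rows m ?T)" using card_open_rows_insert[of m S v] Suc.prems by simp
    then have "open_rows m ?T \<noteq> {}" using False by auto
    have cardT: "card ?T \<le> Suc (card S)" using card_insert_le_m1 \<open>finite S\<close> by (simp add: card_insert_if)
    then obtain w where w: "w \<in> legal_moves ?G ?T" "row w \<in> row ` ?T"
      using exists_idle_move[OF T _ \<open>open_rows m ?T \<noteq> {}\<close> C(1,2) _ C(3)] Suc.prems by auto
    \<comment> \<open>The round has cost at most one open row and two chosen vertices, as the
      induction hypothesis for \<open>k\<close> requires.\<close>
    then have "open_rows m (insert w ?T) = open_rows m ?T" by (auto simp: open_rows_def)
    moreover have "card (insert w ?T) \<le> Suc (Suc (card S))"
      using cardT \<open>finite S\<close> by (simp add: card_insert_if)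
    moreover have "insert w ?T \<subseteq> pverts (clique_array m n R)"
      using T w by (auto simp: legal_moves_def)
    ultimately have "2 * k - 1 \<le> remaining_moves ?G Dominator (insert w ?T)"
      using k Suc.prems by (intro Suc.IH) auto
    moreover have "\<not> verts ?G \<subseteq> dominated ?G ?T"
      using not_dominated_if_open_rows[OF T] assms \<open>open_rows m ?T \<noteq> {}\<close> by simp
    ultimately have "Suc (2 * k - 1) \<le> remaining_moves ?G Staller ?T"
      using remaining_moves_Staller_ge[OF fin _ w(1)] by blast
    then show ?thesis by simp
  qed
  then have "Suc (2 * k) \<le> remaining_moves ?G Dominator S"
    by (rule remaining_moves_Dominator_ge[OF fin undom])
  then show ?case by simp
qed

theorem theorem4p2:
  fixes m :: nat
  assumes "m \<ge> 3"
  shows "\<exists>G H :: nat pair_pre_digraph.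
           pair_graph G \<and> k_connected 3 (with_proj G) \<and>
           pair_graph H \<and> k_connected 2 (with_proj H) \<and>
           spanning (with_proj H) (with_proj G) \<and>
           \<gamma>\<^sub>g (with_proj G) \<ge> 2 * m - 2 \<and>
           \<gamma>\<^sub>g (with_proj H) = m"
proof -
  define Q :: "nat rel" where "Q = {1..3} \<times> {1..3}"
  \<comment> \<open>These \<open>2 * m\<close> columns are the supply that the lower bound asks for
    when it starts from the empty set with \<open>k = m\<close>.\<close>
  define C :: "nat set" where "C = {4..<2 * m + 4}"
  define R where "R = Q \<union> Id_on C"
  define n where "n = 2 * m + 4"
  let ?G = "clique_array m n R" and ?H = "clique_array m n Q"
  have sym: "sym Q" "sym R" by (auto simp: sym_def Q_def R_def)
  \<comment> \<open>Staller's strategy gives one move more than the claimed bound.\<close>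
  have "2 * m - 1 \<le> remaining_moves (with_proj ?G) Dominator {}"
  proof (rule remaining_moves_clique_array_ge)
    show "C \<subseteq> {..<n}" "finite C" "n > 0" "0 \<notin> Range R"
      by (auto simp: C_def n_def R_def Q_def)
    show "(s, t) \<in> R \<longleftrightarrow> s = t" if "t \<in> C" for s t
      using that by (auto simp: R_def Q_def C_def)
  qed (simp_all add: open_rows_def C_def)
  then have "2 * m - 2 \<le> \<gamma>\<^sub>g (with_proj ?G)"
    by (simp add: game_domination_number_def)
  moreover have "\<gamma>\<^sub>g (with_proj ?H) = m"
  proof (rule antisym)
    \<comment> \<open>Dominator opens in column 1, inside the large clique.\<close>
    show "\<gamma>\<^sub>g (with_proj ?H) \<le> m"
      using assms by (intro game_domination_number_clique_array_le[OF _ _ Q_def, of _ 1])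
        (auto simp: n_def)
    show "m \<le> \<gamma>\<^sub>g (with_proj ?H)"
      by (rule game_domination_number_clique_array_ge) (auto simp: n_def Q_def)
  qed
  moreover have "k_connected 3 (with_proj ?G)" "k_connected 2 (with_proj ?H)"
    using assms by (auto intro!: k_connected_clique_array simp: n_def Q_def R_def)
  moreover have "spanning (with_proj ?H) (with_proj ?G)"
    using sym by (intro spanning_clique_array) (auto simp: R_def)
  ultimately show ?thesis
    using sym pair_graph_clique_array by blast
qed

end
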